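(* Let $v_k(n)$ denote the maximum number of edges of a $k$-quasiplanar unit distance graph on $n$ vertices. Then: (i) for all positive integers $k$ and $n$, $v_k(n)< 4kn$; (ii) there is an absolute constant $c>0$ such that if $k=k(n)\ge 2$ is an integer-valued function with $k(n)\le 2^{c\log n/\log\log n}$ for all sufficiently large $n$, then $v_{k(n)}(n)\ge (k(n)-1)n-o(n)$ as $n\to\infty$.
   Context: For a positive integer $k$, a $k$-quasiplanar unit distance graph is a (simple) graph $G$ that admits a drawing in the plane in which the vertices are represented by distinct points, every edge is drawn as a straight line segment of length exactly $1$ between the points representing its endpoints (not passing through any other vertex), and there are no $k$ edges that pairwise cross (two edges cross if they have a common point that is interior to both). *)

theory Defs
  imports "HOL-Analysis.Analysis" "HOL-Library.Landau_Symbols"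
begin

definition simple_graph :: "'a set \<Rightarrow> 'a set set \<Rightarrow> bool" where
  "simple_graph V E \<longleftrightarrow> finite V \<and> (\<forall>e\<in>E. \<exists>u\<in>V. \<exists>v\<in>V. u \<noteq> v \<and> e = {u, v})"

definition unit_distance_drawing ::
    "'a set \<Rightarrow> 'a set set \<Rightarrow> ('a \<Rightarrow> real^2) \<Rightarrow> bool" where
  "unit_distance_drawing V E f \<longleftrightarrow>
     inj_on f V \<and>
     (\<forall>u v. {u, v} \<in> E \<longrightarrow>
        dist (f u) (f v) = 1 \<and>
        (\<forall>w\<in>V - {u, v}. f w \<notin> closed_segment (f u) (f v)))"

definition edges_cross :: "('a \<Rightarrow> real^2) \<Rightarrow> 'a set \<Rightarrow> 'a set \<Rightarrow> bool" where
  "edges_cross f e e' \<longleftrightarrow>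
     (\<exists>u v u' v'. e = {u, v} \<and> e' = {u', v'} \<and>
        open_segment (f u) (f v) \<inter> open_segment (f u') (f v') \<noteq> {})"

text \<open>
  For \<open>k = 1\<close> the crossing condition is vacuous for a single edge, so a
  1-quasiplanar graph has no edges.
\<close>

definition quasiplanar_unit_distance_graph :: "nat \<Rightarrow> 'a set \<Rightarrow> 'a set set \<Rightarrow> bool" where
  "quasiplanar_unit_distance_graph k V E \<longleftrightarrow>
     simple_graph V E \<and>
     (\<exists>f. unit_distance_drawing V E f \<and>
        \<not> (\<exists>F\<subseteq>E. finite F \<and> card F = k \<and> pairwise (edges_cross f) F))"

text \<open>
  Every finite graph is isomorphic to one with vertices in \<^typ>\<open>nat\<close>. For
  \<open>k \<ge> 1\<close> the set below contains \<open>0\<close> (the edgeless graph) and is bounded by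
  \<open>n choose 2\<close>, so the maximum is attained.
\<close>

definition max_edges :: "nat \<Rightarrow> nat \<Rightarrow> nat" where
  "max_edges k n = Max {card E | (V :: nat set) E.
     card V = n \<and> quasiplanar_unit_distance_graph k V E}"

end

theory Submission
  imports Defs "HOL-Number_Theory.Number_Theory" "HOL-Computational_Algebra.Squarefree"
    "HOL-Library.Discrete_Functions" "HOL-Real_Asymp.Real_Asymp"
begin

text \<open>
  Upper bound: orient the edges and split them into two classes whose directions span less than
  a right angle. If a class has more than \<open>2 (k - 1) n\<close> edges, it contains a zigzag path of
  \<open>2 k - 1\<close> edges with increasing angles, turning alternately at heads and tails; every other
  edge of it gives \<open>k\<close> pairwise crossing edges.

  Lower bound: in the integer lattice scaled by \<open>1 / sqrt M\<close>, use \<open>k - 1\<close> primitive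
  vectors of norm \<open>sqrt M\<close>, no two parallel, as edge directions on a square grid. If \<open>M\<close> is a
  product of \<open>t\<close> primes having a square root of -1, there are \<open>2 ^ t\<close> such
  vectors, one for each square root of -1 modulo \<open>M\<close>. That sufficiently many such primes are
  bounded by a polynomial in \<open>t\<close> follows from an exponential lower bound on common multiples of
  the numbers \<open>j\<^sup>2 + 1\<close> with \<open>r < j \<le> 2 * r + 1\<close>.
\<close>

section \<open>Zigzag paths and the upper bound\<close>

text \<open>
  Discarding, for every vertex, the edge of least angle at the endpoint of the current kind
  costs at most \<open>card V\<close> edges, and every remaining edge can be preceded by a discarded or
  remaining one of smaller angle.
\<close>

lemma increasing_zigzag_exists:
  fixes A :: "('v \<times> 'v) set" and \<theta> :: "'v \<times> 'v \<Rightarrow> real"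
  assumes "finite A" and "A \<subseteq> V \<times> V" and "finite V"
    and "\<And>u v v'. (u, v) \<in> A \<Longrightarrow> (u, v') \<in> A \<Longrightarrow> \<theta> (u, v) = \<theta> (u, v') \<Longrightarrow> v = v'"
    and "\<And>u u' v. (u, v) \<in> A \<Longrightarrow> (u', v) \<in> A \<Longrightarrow> \<theta> (u, v) = \<theta> (u', v) \<Longrightarrow> u = u'"
    and "card A > m * card V"
  shows "\<exists>e. (\<forall>i\<le>m. e i \<in> A) \<and> (\<forall>i<m. \<theta> (e i) < \<theta> (e (Suc i))) \<and>
    (\<forall>i<m. if even i = b then snd (e i) = snd (e (Suc i)) else fst (e i) = fst (e (Suc i)))"
  using assms
proof (induction m arbitrary: A b)
  case 0
  from "0.prems"(6) have "A \<noteq> {}" by (metis card.empty mult_0 less_irrefl)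
  then obtain x where "x \<in> A" by blast
  then show ?case by (intro exI[of _ "\<lambda>_. x"]) simp
next
  case (Suc m)
  define \<pi> :: "'v \<times> 'v \<Rightarrow> 'v" where "\<pi> = (if b then snd else fst)"
  define B where "B = {x \<in> A. \<exists>y\<in>A. \<pi> y = \<pi> x \<and> \<theta> y < \<theta> x}"
  \<comment> \<open>Two edges of \<open>A - B\<close> with the same endpoint under
    \<open>\<pi>\<close> both have the least angle there, so their angles agree and the hypotheses
    on \<open>\<theta>\<close> identify them. Hence at most one edge per vertex is lost.\<close>
  have "inj_on \<pi> (A - B)"
  proof (rule inj_onI)
    fix x y assume xy: "x \<in> A - B" "y \<in> A - B" "\<pi> x = \<pi> y"
    have "\<not> \<theta> x < \<theta> y" "\<not> \<theta> y < \<theta> x" using xy unfolding B_def by auto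
    then have eq: "\<theta> x = \<theta> y" by linarith
    obtain u v where x: "x = (u, v)" by (cases x)
    obtain u' v' where y: "y = (u', v')" by (cases y)
    show "x = y"
    proof (cases b)
      case True
      then show ?thesis using xy eq Suc.prems(5)[of u v u'] by (simp add: \<pi>_def x y)
    next
      case False
      then show ?thesis using xy eq Suc.prems(4)[of u v v'] by (simp add: \<pi>_def x y)
    qed
  qed
  moreover have "\<pi> ` (A - B) \<subseteq> V"
    using Suc.prems(2) by (auto simp: \<pi>_def)
  ultimately have "card (A - B) \<le> card V"
    by (rule card_inj_on_le[OF _ _ \<open>finite V\<close>])
  moreover have BA: "B \<subseteq> A" by (auto simp: B_def)
  have "card A = card B + card (A - B)"
    using card_Diff_subset[OF finite_subset[OF BA \<open>finite A\<close>] BA] card_mono[OF \<open>finite A\<close> BA] by simp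
  ultimately have "card B > m * card V" using Suc.prems(6) by simp
  moreover have "v = v'" if "(u, v) \<in> B" "(u, v') \<in> B" "\<theta> (u, v) = \<theta> (u, v')" for u v v'
    using Suc.prems(4)[of u v v'] that by (auto simp: B_def)
  moreover have "u = u'" if "(u, v) \<in> B" "(u', v) \<in> B" "\<theta> (u, v) = \<theta> (u', v)" for u u' v
    using Suc.prems(5)[of u v u'] that by (auto simp: B_def)
  moreover have "finite B" "B \<subseteq> V \<times> V"
    using \<open>finite A\<close> \<open>A \<subseteq> V \<times> V\<close> BA finite_subset by auto
  \<comment> \<open>Prepending an edge shifts all indices by one and so swaps the parity of the
    turns; the induction hypothesis is therefore used with \<open>\<not> b\<close>.\<close>
  ultimately have "\<exists>e. (\<forall>i\<le>m. e i \<in> B) \<and> (\<forall>i<m. \<theta> (e i) < \<theta> (e (Suc i))) \<and>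
    (\<forall>i<m. if even i = (\<not> b) then snd (e i) = snd (e (Suc i)) else fst (e i) = fst (e (Suc i)))"
    by (intro Suc.IH \<open>finite V\<close>)
  then obtain e where e: "\<forall>i\<le>m. e i \<in> B" "\<forall>i<m. \<theta> (e i) < \<theta> (e (Suc i))"
    "\<forall>i<m. if even i = (\<not> b) then snd (e i) = snd (e (Suc i)) else fst (e i) = fst (e (Suc i))"
    by blast
  from e(1) obtain y where y: "y \<in> A" "\<pi> y = \<pi> (e 0)" "\<theta> y < \<theta> (e 0)"
    by (auto simp: B_def)
  show ?case
  proof (intro exI[of _ "case_nat y e"] conjI allI impI)
    fix i assume "i \<le> Suc m"
    then show "case_nat y e i \<in> A" using y e(1) BA by (cases i) auto
  next
    fix i assume "i < Suc m"
    then show "\<theta> (case_nat y e i) < \<theta> (case_nat y e (Suc i))" using y e(2) by (cases i) auto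
  next
    fix i assume "i < Suc m"
    then show "if even i = b then snd (case_nat y e i) = snd (case_nat y e (Suc i))
         else fst (case_nat y e i) = fst (case_nat y e (Suc i))"
      using y(2) e(3) by (cases i) (auto simp: \<pi>_def)
  qed
qed

text \<open>Cramer's rule: the equation \<open>p - x *\<^sub>R d = p' - y *\<^sub>R d'\<close> has
  the solution \<open>x = \<gamma> / D\<close>, \<open>y = \<alpha> / D\<close>, and the four
  inequalities place both parameters strictly between 0 and 1.\<close>

lemma open_segments_intersect:
  fixes p p' d d' :: "real^2"
  defines "D \<equiv> d$1 * d'$2 - d$2 * d'$1"
    and "\<alpha> \<equiv> d$1 * (p'-p)$2 - d$2 * (p'-p)$1"
    and "\<gamma> \<equiv> d'$1 * (p'-p)$2 - d'$2 * (p'-p)$1"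
  assumes "0 < \<alpha>" "\<alpha> < D" "0 < \<gamma>" "\<gamma> < D"
  shows "open_segment (p - d) p \<inter> open_segment (p' - d') p' \<noteq> {}"
proof -
  have D: "D > 0" using assms by linarith
  have "\<gamma> * d $ 1 - \<alpha> * d' $ 1 = D * (p - p') $ 1" "\<gamma> * d $ 2 - \<alpha> * d' $ 2 = D * (p - p') $ 2"
    unfolding D_def \<alpha>_def \<gamma>_def by (simp_all add: algebra_simps)
  then have "(\<gamma> / D) * d $ 1 - (\<alpha> / D) * d' $ 1 = (p - p') $ 1" "(\<gamma> / D) * d $ 2 - (\<alpha> / D) * d' $ 2 = (p - p') $ 2"
    using D by (simp_all add: field_simps)
  then have eq: "p - (\<gamma> / D) *\<^sub>R d = p' - (\<alpha> / D) *\<^sub>R d'"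
    by (simp add: vec_eq_iff forall_2 algebra_simps)
  have seg: "q - x *\<^sub>R c \<in> open_segment (q - c) q" if "0 < x" "x < 1" "c \<noteq> 0" for q c :: "real^2" and x :: real
    unfolding in_segment using that
    by (auto intro!: exI[of _ "1 - x"] simp: algebra_simps)
  have "d \<noteq> 0" "d' \<noteq> 0" using D by (auto simp: D_def)
  then have "p - (\<gamma> / D) *\<^sub>R d \<in> open_segment (p - d) p" "p' - (\<alpha> / D) *\<^sub>R d' \<in> open_segment (p' - d') p'"
    using assms D by (auto intro!: seg)
  then show ?thesis using eq by auto
qed

text \<open>
  The cross products of \<open>e i\<close> with the endpoints of \<open>e j\<close> (and vice versa) are alternating sums
  of sines of an increasing sequence of angles below \<open>pi / 2\<close>, which fixes their signs.
\<close>

lemma zigzag_crossing: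
  fixes f :: "'v \<Rightarrow> real^2" and e :: "nat \<Rightarrow> 'v \<times> 'v" and \<theta> :: "nat \<Rightarrow> real"
  assumes dir: "\<And>i. i \<le> m \<Longrightarrow> f (snd (e i)) - f (fst (e i)) = vector [cos (\<theta> i), sin (\<theta> i)]"
    and mono: "\<And>i. i < m \<Longrightarrow> \<theta> i < \<theta> (Suc i)"
    and range: "\<theta> m < \<theta> 0 + pi / 2"
    and zig: "\<And>i. i < m \<Longrightarrow> if even i then snd (e i) = snd (e (Suc i)) else fst (e i) = fst (e (Suc i))"
    and ij: "even i" "even j" "i < j" "j \<le> m"
  shows "open_segment (f (fst (e i))) (f (snd (e i))) \<inter> open_segment (f (fst (e j))) (f (snd (e j))) \<noteq> {}"
proof -
  define d :: "nat \<Rightarrow> real^2" where "d i = vector [cos (\<theta> i), sin (\<theta> i)]" for i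
  have d12: "d i $ 1 = cos (\<theta> i)" "d i $ 2 = sin (\<theta> i)" for i by (simp_all add: d_def)
  define P where "P i = f (snd (e i))" for i
  have fst_e: "f (fst (e i)) = P i - d i" if "i \<le> m" for i
    using dir[OF that] by (simp add: P_def d_def algebra_simps)
  have less: "\<theta> a < \<theta> b" if "a < b" "b \<le> m" for a b
    using that
  proof (induction b)
    case (Suc b) then show ?case using mono[of b] by (cases "a = b") auto
  qed simp
  have le: "\<theta> a \<le> \<theta> b" if "a \<le> b" "b \<le> m" for a b
    using less[of a b] that by (cases "a = b") auto
  \<comment> \<open>All angle differences that occur lie between 0 and \<open>pi / 2\<close>, where
    the sine is strictly increasing.\<close>
  have sin_less: "sin (\<theta> b - \<theta> a) < sin (\<theta> b' - \<theta> a')"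
    if "a \<le> b" "b \<le> m" "a' \<le> b'" "b' \<le> m" "\<theta> b - \<theta> a < \<theta> b' - \<theta> a'" for a b a' b'
    using that le[of a b] le[of a' b'] le[of 0 a'] le[of b' m] range pi_gt_zero
    by (intro sin_monotone_2pi) (auto simp: field_simps)
  \<comment> \<open>Edges \<open>a\<close> and \<open>a + 1\<close> share a head and edges
    \<open>a + 1\<close> and \<open>a + 2\<close> share a tail: from the head of edge
    \<open>a\<close>, walk back along \<open>a + 1\<close> and forward along
    \<open>a + 2\<close>.\<close>
  have step: "P (Suc (Suc a)) = P a - d (Suc a) + d (Suc (Suc a))" if "even a" "Suc (Suc a) \<le> m" for a
  proof -
    have "P (Suc a) = P a" using zig[of a] that by (simp add: P_def)
    moreover have "P (Suc (Suc a)) - d (Suc (Suc a)) = P (Suc a) - d (Suc a)"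
      using zig[of "Suc a"] that fst_e[of "Suc a"] fst_e[of "Suc (Suc a)"] by simp
    ultimately show ?thesis by (simp add: algebra_simps)
  qed
  define X where "X x y = x$1 * y$2 - x$2 * y$1" for x y :: "real^2"
  have X_lin: "X x (y + z) = X x y + X x z" "X x (y - z) = X x y - X x z" for x y z
    by (simp_all add: X_def algebra_simps)
  have X_d: "X (d a) (d b) = sin (\<theta> b - \<theta> a)" for a b
    by (simp add: X_def d12 sin_diff algebra_simps)
  \<comment> \<open>Each step of two edges adds a difference of consecutive sines, which is
    positive. Since the value so far is below the sine for \<open>b\<close>, which is below the one
    for \<open>b + 1\<close>, the new total stays below the sine for \<open>b + 2\<close>.\<close>
  have fwd: "0 < X (d a) (P (a + 2 * Suc r) - P a) \<and> X (d a) (P (a + 2 * Suc r) - P a) < sin (\<theta> (a + 2 * Suc r) - \<theta> a)"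
    if "even a" "a + 2 * Suc r \<le> m" for a r
    using that
  proof (induction r)
    case 0
    have "X (d a) (P (a + 2) - P a) = sin (\<theta> (a + 2) - \<theta> a) - sin (\<theta> (a + 1) - \<theta> a)"
      using step[of a] 0 by (simp add: X_lin X_d)
    moreover have "sin (\<theta> (a + 1) - \<theta> a) < sin (\<theta> (a + 2) - \<theta> a)"
      using 0 less[of "a + 1" "a + 2"] by (intro sin_less) auto
    moreover have "sin (\<theta> a - \<theta> a) < sin (\<theta> (a + 1) - \<theta> a)"
      using 0 less[of a "a + 1"] by (intro sin_less) auto
    ultimately show ?case by simp
  next
    case (Suc r)
    define b where "b = a + 2 * Suc r"
    have b: "even b" "b + 2 \<le> m" "a \<le> b" using Suc.prems by (auto simp: b_def)
    have "X (d a) (P (b + 2) - P a) = X (d a) (P b - P a) + sin (\<theta> (b + 2) - \<theta> a) - sin (\<theta> (b + 1) - \<theta> a)"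
      using step[of b] b by (simp add: X_lin X_d)
    moreover have "sin (\<theta> (b + 1) - \<theta> a) < sin (\<theta> (b + 2) - \<theta> a)"
      using b less[of "b + 1" "b + 2"] by (intro sin_less) auto
    moreover have "sin (\<theta> b - \<theta> a) < sin (\<theta> (b + 1) - \<theta> a)"
      using b less[of b "b + 1"] by (intro sin_less) auto
    moreover have "0 < X (d a) (P b - P a)" "X (d a) (P b - P a) < sin (\<theta> b - \<theta> a)"
      using Suc b by (auto simp: b_def)
    ultimately show ?case unfolding b_def by simp
  qed
  \<comment> \<open>Here \<open>b\<close> is the reference direction, so the induction keeps
    \<open>b\<close> fixed and moves the start \<open>a\<close> backwards.\<close>
  have bwd: "0 < X (d b) (P b - P a) \<and> X (d b) (P b - P a) < sin (\<theta> b - \<theta> a)"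
    if "even a" "b = a + 2 * Suc r" "b \<le> m" for a b r
    using that
  proof (induction r arbitrary: a)
    case 0
    have "X (d b) (P b - P a) = - sin (\<theta> (a + 1) - \<theta> b)"
      using step[of a] 0 by (simp add: X_lin X_d)
    then have "X (d b) (P b - P a) = sin (\<theta> b - \<theta> (a + 1))"
      using sin_minus[of "\<theta> b - \<theta> (a + 1)"] by simp
    moreover have "sin (\<theta> b - \<theta> (a + 1)) < sin (\<theta> b - \<theta> a)"
      using 0 less[of "a" "a + 1"] by (intro sin_less) auto
    moreover have "sin (\<theta> b - \<theta> b) < sin (\<theta> b - \<theta> (a + 1))"
      using 0 less[of "a + 1" b] by (intro sin_less) auto
    ultimately show ?case by simp
  next
    case (Suc r)
    have a: "even (a + 2)" "b = (a + 2) + 2 * Suc r" "a + 2 \<le> b" "b \<le> m" using Suc.prems by auto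
    have neg: "sin (\<theta> x - \<theta> b) = - sin (\<theta> b - \<theta> x)" for x
      using sin_minus[of "\<theta> b - \<theta> x"] by simp
    have "X (d b) (P b - P a) = X (d b) (P b - P (a + 2)) - sin (\<theta> b - \<theta> (a + 2)) + sin (\<theta> b - \<theta> (a + 1))"
      using step[of a] a neg[of "a + 1"] neg[of "a + 2"] by (simp add: X_lin X_d)
    moreover have "sin (\<theta> b - \<theta> (a + 2)) < sin (\<theta> b - \<theta> (a + 1))"
      using a less[of "a + 1" "a + 2"] by (intro sin_less) auto
    moreover have "sin (\<theta> b - \<theta> (a + 1)) < sin (\<theta> b - \<theta> a)"
      using a less[of a "a + 1"] by (intro sin_less) auto
    ultimately show ?case using Suc.IH[OF a(1,2,4)] by simp
  qed
  obtain r where r: "j = i + 2 * Suc r"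
  proof -
    have "even (j - i)" "j - i > 0" using ij by auto
    then obtain s where "j - i = 2 * s" "s > 0" by (metis evenE nat_0_less_mult_iff)
    then show ?thesis using that[of "s - 1"] ij by auto
  qed
  have "open_segment (P i - d i) (P i) \<inter> open_segment (P j - d j) (P j) \<noteq> {}"
    using fwd[of i r] bwd[of i j r] ij r X_d[of i j]
    by (intro open_segments_intersect) (auto simp: X_def)
  then show ?thesis using fst_e[of i] fst_e[of j] ij by (simp add: P_def)
qed

text \<open>A larger \<open>A\<close> would contain a zigzag for \<open>m = 2 * (k - 1)\<close>. Its
  edges with even index are \<open>k\<close> in number and cross pairwise by
  \<open>zigzag_crossing\<close>, whose condition on the angles is met because all of them lie in
  one half-open quadrant.\<close>

lemma card_edges_in_quadrant:
  fixes f :: "'v \<Rightarrow> real^2" and \<theta> :: "'v \<times> 'v \<Rightarrow> real"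
  assumes k: "k \<ge> 1" and fin: "finite V" and A: "A \<subseteq> V \<times> V"
    and E: "\<And>u v. (u, v) \<in> A \<Longrightarrow> {u, v} \<in> E"
    and inj: "inj_on f V"
    and dir: "\<And>u v. (u, v) \<in> A \<Longrightarrow> f v - f u = vector [cos (\<theta> (u, v)), sin (\<theta> (u, v))]"
    and range: "\<And>x. x \<in> A \<Longrightarrow> \<alpha> \<le> \<theta> x \<and> \<theta> x < \<alpha> + pi / 2"
    and quasi: "\<not> (\<exists>F\<subseteq>E. finite F \<and> card F = k \<and> pairwise (edges_cross f) F)"
  shows "card A \<le> 2 * (k - 1) * card V"
proof (rule ccontr)
  assume "\<not> ?thesis"
  then have "card A > (2 * (k - 1)) * card V" by simp
  moreover have finA: "finite A" using A fin by (meson finite_SigmaI finite_subset)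
  moreover have "v = v'" if "(u, v) \<in> A" "(u, v') \<in> A" "\<theta> (u, v) = \<theta> (u, v')" for u v v'
  proof -
    have "f v - f u = f v' - f u" using dir[OF that(1)] dir[OF that(2)] that(3) by simp
    then show ?thesis using that A inj by (auto simp: inj_on_def)
  qed
  moreover have "u = u'" if "(u, v) \<in> A" "(u', v) \<in> A" "\<theta> (u, v) = \<theta> (u', v)" for u u' v
  proof -
    have "f v - f u = f v - f u'" using dir[OF that(1)] dir[OF that(2)] that(3) by simp
    then show ?thesis using that A inj by (auto simp: inj_on_def)
  qed
  ultimately have "\<exists>e. (\<forall>i\<le>2 * (k - 1). e i \<in> A) \<and> (\<forall>i<2 * (k - 1). \<theta> (e i) < \<theta> (e (Suc i))) \<and>
    (\<forall>i<2 * (k - 1). if even i = True then snd (e i) = snd (e (Suc i)) else fst (e i) = fst (e (Suc i)))"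
    by (intro increasing_zigzag_exists[OF _ A fin])
  then obtain e where e: "\<forall>i\<le>2 * (k - 1). e i \<in> A" "\<forall>i<2 * (k - 1). \<theta> (e i) < \<theta> (e (Suc i))"
    "\<forall>i<2 * (k - 1). if even i = True then snd (e i) = snd (e (Suc i)) else fst (e i) = fst (e (Suc i))"
    by blast
  define G where "G i = {fst (e (2 * i)), snd (e (2 * i))}" for i
  have cross: "open_segment (f (fst (e (2 * i)))) (f (snd (e (2 * i)))) \<inter>
      open_segment (f (fst (e (2 * j)))) (f (snd (e (2 * j)))) \<noteq> {}" if "i < j" "j < k" for i j
  proof (rule zigzag_crossing[of "2 * (k - 1)" f e "\<lambda>i. \<theta> (e i)"])
    show "f (snd (e i)) - f (fst (e i)) = vector [cos (\<theta> (e i)), sin (\<theta> (e i))]" if "i \<le> 2 * (k - 1)" for i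
      using that e(1) dir[of "fst (e i)" "snd (e i)"] by simp
    show "\<theta> (e (2 * (k - 1))) < \<theta> (e 0) + pi / 2"
      using e(1) range[of "e 0"] range[of "e (2 * (k - 1))"] by fastforce
  qed (use that e(2,3) in auto)
  have less: "\<theta> (e a) < \<theta> (e b)" if "a < b" "b \<le> 2 * (k - 1)" for a b
    using that
  proof (induction b)
    case (Suc b) then show ?case using e(2)[rule_format, of b] by (cases "a = b") auto
  qed simp
  \<comment> \<open>Distinct arcs with the same underlying edge are reverses of each other, so the
    sine of their angle difference vanishes; but that difference is positive and below
    \<open>pi\<close>.\<close>
  have G_neq: "G i \<noteq> G j" if "i < j" "j < k" for i j
  proof
    assume eq: "G i = G j"
    have lt: "\<theta> (e (2 * i)) < \<theta> (e (2 * j))" using that by (intro less) auto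
    have mem: "e (2 * i) \<in> A" "e (2 * j) \<in> A" using e(1) that by auto
    have "\<theta> (e (2 * j)) - \<theta> (e (2 * i)) < pi" using range[OF mem(1)] range[OF mem(2)] pi_gt_zero by linarith
    then have pos: "sin (\<theta> (e (2 * j)) - \<theta> (e (2 * i))) > 0" using lt by (intro sin_gt_zero) auto
    obtain u v where uv: "e (2 * i) = (u, v)" by (cases "e (2 * i)")
    obtain u' v' where uv': "e (2 * j) = (u', v')" by (cases "e (2 * j)")
    have neq: "(u, v) \<noteq> (u', v')" using lt uv uv' by auto
    then have "u = v'" "v = u'" using eq unfolding G_def uv uv' by (auto simp: doubleton_eq_iff)
    then have "f v' - f u' = - (f v - f u)" by simp
    then have "vector [cos (\<theta> (u', v')), sin (\<theta> (u', v'))] = - (vector [cos (\<theta> (u, v)), sin (\<theta> (u, v))] :: real^2)"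
      using dir mem uv uv' by metis
    then have "cos (\<theta> (u', v')) = - cos (\<theta> (u, v))" "sin (\<theta> (u', v')) = - sin (\<theta> (u, v))"
      by (simp_all add: vec_eq_iff forall_2)
    then have "sin (\<theta> (u', v') - \<theta> (u, v)) = 0" by (simp add: sin_diff)
    then show False using pos uv uv' by simp
  qed
  have "inj_on G {..<k}"
    by (rule inj_onI) (metis G_neq lessThan_iff linorder_less_linear)
  then have "card (G ` {..<k}) = k" by (simp add: card_image)
  moreover have "G ` {..<k} \<subseteq> E"
    using e(1) E[of "fst (e _)" "snd (e _)"] by (auto simp: G_def)
  moreover have "edges_cross f (G i) (G j)" if "G i \<noteq> G j" "i < k" "j < k" for i j
  proof (cases "i < j")
    case True
    then show ?thesis using cross[of i j] that unfolding edges_cross_def G_def by blast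
  next
    case False
    then have "j < i" using that by (metis linorder_neqE_nat)
    then show ?thesis using cross[of j i] that unfolding edges_cross_def G_def by blast
  qed
  then have "pairwise (edges_cross f) (G ` {..<k})"
    by (auto simp: pairwise_def)
  ultimately show False using quasi by blast
qed

lemma unit_vector_polar:
  fixes d :: "real^2"
  assumes "norm d = 1"
  obtains \<theta> where "0 \<le> \<theta>" "\<theta> < 2 * pi" "d = vector [cos \<theta>, sin \<theta>]"
proof -
  have "(d $ 1)\<^sup>2 + (d $ 2)\<^sup>2 = 1"
    using assms by (simp add: norm_vec_def L2_set_def sum_2)
  then obtain t where t: "0 \<le> t" "t < 2 * pi" "d $ 1 = cos t" "d $ 2 = sin t"
    using sincos_total_2pi by metis
  then show ?thesis using that[of t] by (auto simp: vec_eq_iff forall_2)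
qed

section \<open>The edge bound for the whole graph and the maximum\<close>

text \<open>One of the two orientations of an edge has an angle in the range from 0 to
  \<open>pi\<close>, with \<open>pi\<close> excluded. The classes \<open>A 0\<close> and
  \<open>A (pi / 2)\<close> cover this range, and each is bounded by the quadrant lemma.\<close>

lemma card_quasiplanar_le:
  fixes V :: "'v set"
  assumes k: "k \<ge> 1" and q: "quasiplanar_unit_distance_graph k V E"
  shows "card E \<le> 4 * (k - 1) * card V"
proof -
  from q obtain f where sg: "simple_graph V E" and f: "unit_distance_drawing V E f"
    and quasi: "\<not> (\<exists>F\<subseteq>E. finite F \<and> card F = k \<and> pairwise (edges_cross f) F)"
    unfolding quasiplanar_unit_distance_graph_def by blast
  have fin: "finite V" and inj: "inj_on f V"
    using sg f by (auto simp: simple_graph_def unit_distance_drawing_def)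
  have "\<exists>t. 0 \<le> t \<and> t < 2 * pi \<and> f v - f u = vector [cos t, sin t]" if "{u, v} \<in> E" for u v
  proof -
    have "norm (f v - f u) = 1" using f that by (simp add: unit_distance_drawing_def dist_norm norm_minus_commute)
    then show ?thesis by (metis unit_vector_polar)
  qed
  then have "\<forall>x. \<exists>t. {fst x, snd x} \<in> E \<longrightarrow> 0 \<le> t \<and> t < 2 * pi \<and> f (snd x) - f (fst x) = vector [cos t, sin t]"
    by blast
  then obtain \<theta> where "\<forall>x. {fst x, snd x} \<in> E \<longrightarrow> 0 \<le> \<theta> x \<and> \<theta> x < 2 * pi \<and>
      f (snd x) - f (fst x) = vector [cos (\<theta> x), sin (\<theta> x)]"
    by (rule choice[THEN exE])
  then have \<theta>: "0 \<le> \<theta> (u, v) \<and> \<theta> (u, v) < 2 * pi \<and> f v - f u = vector [cos (\<theta> (u, v)), sin (\<theta> (u, v))]"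
    if "{u, v} \<in> E" for u v
    using that by auto
  define A where "A \<alpha> = {x \<in> V \<times> V. {fst x, snd x} \<in> E \<and> \<alpha> \<le> \<theta> x \<and> \<theta> x < \<alpha> + pi / 2}" for \<alpha>
  have cA: "card (A \<alpha>) \<le> 2 * (k - 1) * card V" for \<alpha>
    using k fin inj quasi \<theta>
    by (intro card_edges_in_quadrant[where f = f and \<theta> = \<theta> and \<alpha> = \<alpha>]) (auto simp: A_def)
  have finA: "finite (A \<alpha>)" for \<alpha> using fin by (auto simp: A_def)
  have "E \<subseteq> (\<lambda>(u, v). {u, v}) ` (A 0 \<union> A (pi / 2))"
  proof
    fix x assume "x \<in> E"
    then obtain u v where uv: "u \<in> V" "v \<in> V" "x = {u, v}" using sg by (auto simp: simple_graph_def)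
    have vu: "{v, u} \<in> E" and uvE: "{u, v} \<in> E" using \<open>x \<in> E\<close> uv by (auto simp: insert_commute)
    show "x \<in> (\<lambda>(u, v). {u, v}) ` (A 0 \<union> A (pi / 2))"
    proof (cases "\<theta> (u, v) < pi")
      case True
      then have "(u, v) \<in> A 0 \<union> A (pi / 2)" using uv uvE \<theta>[OF uvE] by (auto simp: A_def)
      then show ?thesis using uv by force
    next
      case False
      \<comment> \<open>If neither orientation had an angle below \<open>pi\<close>, both sines
        would be at most 0 and opposite, hence 0. Both angles would be \<open>pi\<close>, and the
        cosines would agree instead of being opposite.\<close>
      have "\<theta> (v, u) < pi"
      proof (rule ccontr)
        assume neg: "\<not> \<theta> (v, u) < pi"
        have "vector [cos (\<theta> (v, u)), sin (\<theta> (v, u))] = - (vector [cos (\<theta> (u, v)), sin (\<theta> (u, v))] :: real^2)"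
          using \<theta>[OF uvE] \<theta>[OF vu] by (metis minus_diff_eq)
        then have eq: "cos (\<theta> (v, u)) = - cos (\<theta> (u, v))" "sin (\<theta> (v, u)) = - sin (\<theta> (u, v))"
          by (simp_all add: vec_eq_iff forall_2)
        have neg_sin: "t = pi \<or> sin t < 0" if "\<not> t < pi" "t < 2 * pi" for t
          using that sin_lt_zero[of t] by force
        have "\<theta> (v, u) = pi \<and> \<theta> (u, v) = pi"
          using eq(2) neg_sin[OF False] neg_sin[OF neg] \<theta>[OF uvE] \<theta>[OF vu] by force
        then show False using eq(1) by simp
      qed
      then have "(v, u) \<in> A 0 \<union> A (pi / 2)" using uv vu \<theta>[OF vu] by (auto simp: A_def)
      then show ?thesis using uv by force
    qed
  qed
  then have "card E \<le> card (A 0 \<union> A (pi / 2))"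
    using finA by (metis card_image_le card_mono finite_UnI finite_imageI le_trans)
  also have "\<dots> \<le> card (A 0) + card (A (pi / 2))" by (rule card_Un_le)
  also have "\<dots> \<le> 4 * (k - 1) * card V" using cA[of 0] cA[of "pi / 2"] by linarith
  finally show ?thesis .
qed

text \<open>\<open>Max\<close> is meaningful only on a finite nonempty set. The vertex sets range
  over infinitely many sets of naturals, so finiteness is drawn from the edge bound; collinear
  points without edges supply a member.\<close>

lemma max_edges_candidates:
  assumes "k \<ge> 1" "n \<ge> 1"
  defines "S \<equiv> {card E | (V :: nat set) E. card V = n \<and> quasiplanar_unit_distance_graph k V E}"
  shows "finite S" "S \<noteq> {}"
proof -
  have "S \<subseteq> {..4 * (k - 1) * n}" using card_quasiplanar_le assms by (fastforce simp: S_def)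
  then show "finite S" by (rule finite_subset) simp
  define f :: "nat \<Rightarrow> real^2" where "f i = vector [real i, 0]" for i
  have "inj_on f {..<n}" by (auto simp: inj_on_def f_def vec_eq_iff forall_2)
  then have "quasiplanar_unit_distance_graph k {..<n} {}"
    using \<open>k \<ge> 1\<close> unfolding quasiplanar_unit_distance_graph_def simple_graph_def unit_distance_drawing_def
    by (intro conjI exI[of _ f]) auto
  then show "S \<noteq> {}" unfolding S_def by force
qed

lemma max_edges_less:
  assumes "k \<ge> 1" "n \<ge> 1"
  shows "max_edges k n < 4 * k * n"
  unfolding max_edges_def
proof (subst Max_less_iff[OF max_edges_candidates[OF assms]], intro ballI)
  fix a assume "a \<in> {card E | (V :: nat set) E. card V = n \<and> quasiplanar_unit_distance_graph k V E}"
  then have "a \<le> 4 * (k - 1) * n" using card_quasiplanar_le assms by fastforce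
  also have "\<dots> < 4 * k * n" using assms by simp
  finally show "a < 4 * k * n" .
qed

lemma card_le_max_edges:
  fixes V :: "nat set"
  assumes "k \<ge> 1" "n \<ge> 1" "card V = n" "quasiplanar_unit_distance_graph k V E"
  shows "card E \<le> max_edges k n"
  unfolding max_edges_def using assms by (intro Max_ge max_edges_candidates(1)) auto

section \<open>Many primitive vectors of the same length\<close>

text \<open>
  The quotient satisfies the recurrence \<open>f (r + 1) z = f r z - f r (z + 1)\<close>; as each
  \<open>L / (j + \<i>)\<close> is a Gaussian integer, so are all quotients.
\<close>

lemma gaussian_partial_fractions:
  fixes L r k :: nat
  assumes "\<And>j. k \<le> j \<Longrightarrow> j \<le> k + r \<Longrightarrow> j\<^sup>2 + 1 dvd L"
  shows "\<exists>a b :: int. of_nat L * fact r / pochhammer (Complex (real k) 1) (Suc r) = Complex (of_int a) (of_int b)"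
  using assms
proof (induction r arbitrary: k)
  case 0
  then obtain q where q: "L = (k\<^sup>2 + 1) * q" by (auto elim: dvdE)
  have nz: "Complex (real k) 1 \<noteq> 0" by (simp add: complex_eq_iff)
  \<comment> \<open>The conjugate \<open>k - \<i>\<close> times \<open>q\<close> is the quotient,
    since \<open>k\<^sup>2 + 1\<close> is the norm of \<open>k + \<i>\<close>.\<close>
  have "of_nat L = Complex (real k) 1 * Complex (real (k * q)) (- real q)"
    unfolding q by (simp add: complex_eq_iff power2_eq_square algebra_simps)
  then have "of_nat L / Complex (real k) 1 = Complex (of_int (int (k * q))) (of_int (- int q))"
    using nz by (simp add: field_simps)
  then have "\<exists>a b. of_nat L / Complex (real k) 1 = Complex (of_int a) (of_int b)" by blast
  then show ?case by (simp add: pochhammer_Suc)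
next
  case (Suc r)
  define z where "z = Complex (real k) 1"
  have z1: "Complex (real (Suc k)) 1 = z + 1" by (simp add: z_def complex_eq_iff)
  have nz: "z + of_nat j \<noteq> 0" for j by (simp add: z_def complex_eq_iff)
  obtain a b where ab: "of_nat L * fact r / pochhammer z (Suc r) = Complex (of_int a) (of_int b)"
    using Suc.IH[of k] Suc.prems by (auto simp: z_def)
  obtain a' b' where ab': "of_nat L * fact r / pochhammer (z + 1) (Suc r) = Complex (of_int a') (of_int b')"
    using Suc.IH[of "Suc k"] Suc.prems unfolding z1 by auto
  define Q where "Q = pochhammer (z + 1) r"
  have "pochhammer (z + 1) r \<noteq> 0"
    using nz[of "Suc _"] by (auto simp: pochhammer_eq_0_iff eq_neg_iff_add_eq_0 add_ac)
  then have Q: "Q \<noteq> 0" by (simp add: Q_def)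
  have p1: "pochhammer z (Suc r) = z * Q" by (simp add: Q_def pochhammer_rec)
  have p2: "pochhammer (z + 1) (Suc r) = Q * (z + 1 + of_nat r)" by (simp add: Q_def pochhammer_Suc)
  have p3: "pochhammer z (Suc (Suc r)) = z * (Q * (z + 1 + of_nat r))"
    by (simp only: pochhammer_rec[of z "Suc r"] p2)
  have nz': "z \<noteq> 0" "z + 1 + of_nat r \<noteq> 0" using nz[of 0] nz[of "Suc r"] by (simp_all add: add_ac)
  have "of_nat L * fact (Suc r) / pochhammer z (Suc (Suc r)) =
      of_nat L * fact r / pochhammer z (Suc r) - of_nat L * fact r / pochhammer (z + 1) (Suc r)"
    unfolding p1 p2 p3 using Q nz' by (simp add: divide_simps) (simp add: algebra_simps)
  also have "\<dots> = Complex (of_int (a - a')) (of_int (b - b'))"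
    unfolding ab ab' by (simp add: complex_eq_iff)
  finally show ?case unfolding z_def by blast
qed

section \<open>Primes modulo which -1 is a square\<close>

text \<open>\<open>L * fact r\<close> divided by the product of all \<open>j + \<i>\<close> with
  \<open>r < j \<le> 2 * r + 1\<close> is a nonzero Gaussian integer, so its modulus is at least 1.
  As \<open>j + \<i>\<close> has modulus at least \<open>j\<close>, this gives
  \<open>L \<ge> (2 * r + 1) * (2 * r choose r)\<close>, and the central binomial coefficient
  supplies \<open>4 ^ r\<close>.\<close>

lemma common_multiple_ge:
  fixes L r :: nat
  assumes "L > 0" and "\<And>j. r < j \<Longrightarrow> j \<le> 2 * r + 1 \<Longrightarrow> j\<^sup>2 + 1 dvd L"
  shows "4 ^ r \<le> L"
proof -
  define P where "P = pochhammer (Complex (real (Suc r)) 1) (Suc r)"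
  obtain a b :: int where ab: "of_nat L * fact r / P = Complex (of_int a) (of_int b)"
    using gaussian_partial_fractions[of "Suc r" r L] assms(2) unfolding P_def by auto
  have nz: "Complex (real (Suc r)) 1 + of_nat j \<noteq> 0" for j by (simp add: complex_eq_iff)
  have "P \<noteq> 0" unfolding P_def using nz by (auto simp: pochhammer_eq_0_iff eq_neg_iff_add_eq_0)
  then have "Complex (of_int a) (of_int b) \<noteq> 0" using \<open>L > 0\<close> unfolding ab[symmetric] by simp
  then have "a\<^sup>2 + b\<^sup>2 \<noteq> 0" by (simp add: complex_eq_iff sum_power2_eq_zero_iff)
  then have "1 \<le> a\<^sup>2 + b\<^sup>2" by (smt (verit) zero_le_power2)
  then have "1 \<le> (real_of_int a)\<^sup>2 + (real_of_int b)\<^sup>2"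
    by (metis of_int_1_le_iff of_int_add of_int_power)
  then have "1 \<le> norm (of_nat L * fact r / P)"
    unfolding ab by (simp add: cmod_def)
  then have P_le: "norm P \<le> real L * fact r"
    using \<open>P \<noteq> 0\<close> by (simp add: norm_divide norm_mult norm_fact divide_simps)
  have "pochhammer (real (Suc r)) m \<le> norm (pochhammer (Complex (real (Suc r)) 1) m)" for m
  proof (induction m)
    case (Suc m)
    have "real (Suc r) + real m = \<bar>Re (Complex (real (Suc r)) 1 + of_nat m)\<bar>" by simp
    also have "\<dots> \<le> norm (Complex (real (Suc r)) 1 + of_nat m)" by (rule abs_Re_le_cmod)
    finally show ?case using Suc unfolding pochhammer_Suc norm_mult
      by (intro mult_mono) auto
  qed simp
  then have "pochhammer (real (Suc r)) (Suc r) \<le> real L * fact r"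
    using P_le unfolding P_def by (meson order_trans)
  moreover have "pochhammer (real (Suc r)) m * fact r = fact (r + m)" for m
  proof (induction m)
    case (Suc m)
    have "pochhammer (real (Suc r)) (Suc m) * fact r = (real (Suc r) + real m) * (pochhammer (real (Suc r)) m * fact r)"
      by (simp add: pochhammer_Suc)
    then show ?case unfolding Suc by (simp add: algebra_simps)
  qed simp
  ultimately have "fact (r + Suc r) \<le> real L * fact r * fact r"
    by (metis fact_ge_zero mult_right_mono)
  moreover have "real (fact r * fact r * ((2 * r) choose r)) = real (fact (2 * r))"
    using binomial_fact_lemma[of r "2 * r"] by simp
  then have choose: "fact (2 * r) = real ((2 * r) choose r) * (fact r * fact r)"
    by (simp only: of_nat_mult of_nat_fact mult_ac)
  have "r + Suc r = Suc (2 * r)" by simp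
  then have "fact (r + Suc r) = real (Suc (2 * r)) * fact (2 * r)" by (simp only: fact_Suc)
  then have "fact (r + Suc r) = real (2 * r + 1) * real ((2 * r) choose r) * (fact r * fact r)"
    unfolding choose by simp
  ultimately have "real (2 * r + 1) * real ((2 * r) choose r) * (fact r * fact r) \<le> real L * (fact r * fact r)"
    by (simp only: mult.assoc)
  then have *: "real (2 * r + 1) * real ((2 * r) choose r) \<le> real L"
    by (rule mult_right_le_imp_le) simp
  show ?thesis
  proof (cases "r = 0")
    case False
    then have "4 ^ r / (2 * real r) \<le> real ((2 * r) choose r)"
      using central_binomial_lower_bound[of r] by simp
    then have "4 ^ r \<le> 2 * real r * real ((2 * r) choose r)"
      using False by (simp add: field_simps)
    also have "\<dots> \<le> real (2 * r + 1) * real ((2 * r) choose r)"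
      by (intro mult_right_mono) auto
    finally have "4 ^ r \<le> real L" using * by (rule order_trans)
    then have "real (4 ^ r) \<le> real L" by simp
    then show ?thesis by (simp only: of_nat_le_iff)
  qed (use \<open>L > 0\<close> in auto)
qed

text \<open>Multiply, over all \<open>p\<close> in \<open>P\<close>, the largest power of
  \<open>p\<close> not exceeding \<open>X\<close>. Prime powers dividing some
  \<open>a \<le> X\<close> divide these powers, and each of the \<open>card P\<close> factors is at
  most \<open>X\<close>.\<close>

lemma exists_common_multiple_le:
  fixes A P :: "nat set"
  assumes "finite P" "\<And>p. p \<in> P \<Longrightarrow> prime p" "\<And>a. a \<in> A \<Longrightarrow> prime_factors a \<subseteq> P"
    and "\<And>a. a \<in> A \<Longrightarrow> 0 < a \<and> a \<le> X" and "X > 0"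
  shows "\<exists>L>0. (\<forall>a\<in>A. a dvd L) \<and> L \<le> X ^ card P"
proof -
  define h where "h p = Max {e. p ^ e \<le> X}" for p
  have fin: "finite {e. p ^ e \<le> X}" if "p \<in> P" for p
  proof (rule finite_subset)
    have "e < p ^ e" for e using assms(2)[OF that] prime_gt_1_nat by (intro power_gt_expt) simp
    then show "{e. p ^ e \<le> X} \<subseteq> {..X}" by (fastforce dest: less_le_trans)
  qed simp
  define L where "L = (\<Prod>p\<in>P. p ^ h p)"
  have "p ^ h p \<le> X" if "p \<in> P" for p
  proof -
    have "0 \<in> {e. p ^ e \<le> X}" using \<open>X > 0\<close> by simp
    then show ?thesis using Max_in[OF fin[OF that]] unfolding h_def by blast
  qed
  then have "L \<le> (\<Prod>p\<in>P. X)" unfolding L_def by (intro prod_mono) auto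
  moreover have "L > 0" unfolding L_def using assms(2) by (intro prod_pos) (auto simp: prime_gt_0_nat)
  moreover have "a dvd L" if "a \<in> A" for a
  proof -
    have a: "a > 0" "a \<le> X" "prime_factors a \<subseteq> P" using assms that by auto
    have "p ^ multiplicity p a dvd p ^ h p" if "p \<in> P" for p
    proof -
      have "p ^ multiplicity p a \<le> X" using multiplicity_dvd[of p a] a by (meson dvd_imp_le le_trans)
      then show ?thesis unfolding h_def using fin[OF that] by (intro le_imp_power_dvd Max_ge) auto
    qed
    then have "(\<Prod>p\<in>P. p ^ multiplicity p a) dvd L"
      unfolding L_def by (intro prod_dvd_prod) auto
    moreover have "(\<Prod>p\<in>prime_factors a. p ^ multiplicity p a) = (\<Prod>p\<in>P. p ^ multiplicity p a)"
      using a assms(1,2) by (intro prod.mono_neutral_left) (auto simp: prime_factors_multiplicity)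
    moreover have "(\<Prod>p\<in>prime_factors a. p ^ multiplicity p a) = a"
      using a prod_prime_factors[of a] by simp
    ultimately show ?thesis by simp
  qed
  ultimately show ?thesis by auto
qed

text \<open>Every common multiple of the numbers \<open>j\<^sup>2 + 1\<close> with
  \<open>r < j \<le> 2 * r + 1\<close> is at least \<open>4 ^ r\<close>, yet one of them is at most
  \<open>X ^ card Q\<close>. So the set \<open>Q\<close> of their prime divisors cannot be
  small.\<close>

lemma many_primes_with_sqrt_minus_one:
  fixes t :: nat
  assumes "t \<ge> 1"
  obtains P where "finite P" "card P = t"
    "\<And>p. p \<in> P \<Longrightarrow> prime p \<and> odd p \<and> p \<le> 324 * t ^ 4 \<and> (\<exists>c. p dvd c\<^sup>2 + 1)"
proof -
  \<comment> \<open>If \<open>card Q \<le> t\<close>, then after taking square roots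
    \<open>2 ^ r \<le> (2 * r + 2) ^ t\<close>. For this \<open>r\<close> the base is at most
    \<open>18 * t\<^sup>2 < 2 ^ (5 + 2 * t)\<close>, while \<open>(5 + 2 * t) * t \<le> r\<close>.
    Squaring \<open>18 * t\<^sup>2\<close> also explains the bound \<open>324 * t ^ 4\<close> on
    \<open>X\<close>.\<close>
  define r where "r = 8 * t\<^sup>2"
  define X where "X = (2 * r + 2)\<^sup>2"
  define Q where "Q = {p. prime p \<and> (\<exists>j. r < j \<and> j \<le> 2 * r + 1 \<and> p dvd j\<^sup>2 + 1)}"
  have le_X: "j\<^sup>2 + 1 \<le> X" if "j \<le> 2 * r + 1" for j
  proof -
    have "j\<^sup>2 \<le> (2 * r + 1)\<^sup>2" using that by (rule power_mono) simp
    then show ?thesis unfolding X_def by (simp add: power2_eq_square algebra_simps)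
  qed
  have Q_le: "p \<le> X" if "p \<in> Q" for p
    using that le_X unfolding Q_def by (auto dest!: dvd_imp_le intro: order_trans)
  have finQ: "finite Q" using Q_le by (meson finite_nat_set_iff_bounded_le)
  have "\<exists>L>0. (\<forall>a\<in>(\<lambda>j. j\<^sup>2 + 1) ` {r<..2 * r + 1}. a dvd L) \<and> L \<le> X ^ card Q"
    using finQ le_X by (intro exists_common_multiple_le) (auto simp: Q_def X_def prime_factors_dvd)
  then obtain L where L: "L > 0" "\<And>j. r < j \<Longrightarrow> j \<le> 2 * r + 1 \<Longrightarrow> j\<^sup>2 + 1 dvd L" "L \<le> X ^ card Q"
    by auto
  have "4 ^ r \<le> X ^ card Q" using common_multiple_ge[of L r] L by (meson order_trans)
  also have "4 ^ r = ((2 :: nat) ^ r)\<^sup>2" by (metis numeral_Bit0_eq_double power2_eq_square power_commutes power_mult_distrib mult_2)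
  also have "X ^ card Q = ((2 * r + 2) ^ card Q)\<^sup>2" unfolding X_def by (simp flip: power_mult add: mult.commute)
  finally have le: "2 ^ r \<le> (2 * r + 2) ^ card Q" by (simp add: power2_le_iff_abs_le)
  have t2: "16 * t\<^sup>2 + 2 \<le> 18 * t\<^sup>2" using assms by (simp add: Suc_leI)
  have "card Q > t"
  proof (rule ccontr)
    assume "\<not> card Q > t"
    then have "(2 * r + 2) ^ card Q \<le> (2 * r + 2) ^ t" by (intro power_increasing) auto
    then have "2 ^ r \<le> (2 * r + 2) ^ t" using le by (rule order_trans[rotated])
    also have "\<dots> \<le> (18 * t\<^sup>2) ^ t" using t2 by (intro power_mono) (auto simp: r_def)
    also have "18 * t\<^sup>2 < 2 ^ 5 * (2 ^ t)\<^sup>2"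
      using less_exp[of t] assms by (intro mult_strict_mono power_strict_mono) auto
    then have "(18 * t\<^sup>2) ^ t < (2 ^ 5 * (2 ^ t)\<^sup>2) ^ t" using assms by (intro power_strict_mono) auto
    also have "\<dots> = 2 ^ ((5 + t * 2) * t)" by (simp only: power_add power_mult)
    also have "\<dots> \<le> 2 ^ r" using assms unfolding r_def
      by (intro power_increasing) (auto simp: power2_eq_square algebra_simps)
    finally show False by simp
  qed
  \<comment> \<open>The strict inequality pays for removing 2, modulo which -1 has only one square
    root.\<close>
  then have "card (Q - {2}) \<ge> t" using diff_card_le_card_Diff[of "{2}" Q] by simp
  then obtain P where P: "P \<subseteq> Q - {2}" "card P = t" "finite P"
    by (meson obtain_subset_with_card_n)
  have "X \<le> 324 * t ^ 4"
  proof -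
    have "X \<le> (18 * t\<^sup>2)\<^sup>2" unfolding X_def r_def using t2 by (intro power_mono) auto
    then show ?thesis by (simp add: power_mult_distrib flip: power_mult)
  qed
  show ?thesis
  proof (rule that[OF P(3,2)])
    fix p assume "p \<in> P"
    then have "p \<in> Q" "p \<noteq> 2" using P by auto
    then show "prime p \<and> odd p \<and> p \<le> 324 * t ^ 4 \<and> (\<exists>c. p dvd c\<^sup>2 + 1)"
      using Q_le[of p] \<open>X \<le> 324 * t ^ 4\<close> prime_odd_nat[of p] unfolding Q_def
      by (auto dest: prime_ge_2_nat)
  qed
qed

section \<open>Square roots of -1 and sums of two squares\<close>

text \<open>An odd prime \<open>p\<close> of this kind has two distinct roots \<open>x\<close> and
  \<open>p - x\<close>. By the Chinese remainder theorem each combines with every root modulo the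
  product of the other primes, so every prime doubles the count.\<close>

lemma card_sqrt_minus_one_prod:
  fixes P :: "nat set"
  assumes "finite P" "\<And>p. p \<in> P \<Longrightarrow> prime p \<and> odd p \<and> (\<exists>c. p dvd c\<^sup>2 + 1)"
  shows "2 ^ card P \<le> card {c. c < \<Prod>P \<and> \<Prod>P dvd c\<^sup>2 + 1}"
  using assms
proof (induction P rule: finite_induct)
  case empty
  have "{c. c < (1 :: nat)} = {0}" by auto
  then show ?case by simp
next
  case (insert p P)
  define M where "M = \<Prod>P"
  define R where "R N = {c. c < N \<and> N dvd c\<^sup>2 + 1}" for N :: nat
  have p: "prime p" "odd p" "p > 0" using insert.prems[of p] by (auto simp: prime_gt_0_nat)
  have M: "M > 0" unfolding M_def using insert.prems by (intro prod_pos) (auto simp: prime_gt_0_nat)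
  have cop: "coprime M p" unfolding M_def
    using insert by (intro prod_coprime_left) (auto intro!: primes_coprime)
  from insert.prems[of p] obtain d where d: "p dvd d\<^sup>2 + 1" by auto
  define x where "x = d mod p"
  have x: "x < p" "p dvd x\<^sup>2 + 1"
  proof -
    have "[d mod p = d] (mod p)" by simp
    then have "[(d mod p)\<^sup>2 + 1 = d\<^sup>2 + 1] (mod p)" by (intro cong_add cong_pow) auto
    then show "p dvd x\<^sup>2 + 1" using d by (simp add: x_def cong_dvd_iff)
    show "x < p" using p by (simp add: x_def)
  qed
  have x0: "x \<noteq> 0" using x p by (metis add_0 not_prime_1 nat_dvd_1_iff_1 zero_power2 one_neq_zero)
  have xp: "p - x < p" "p dvd (p - x)\<^sup>2 + 1" "p - x \<noteq> x"
  proof -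
    have "[int (p - x) = - int x] (mod int p)" using x by (simp add: cong_iff_dvd_diff of_nat_diff)
    then have "[(int (p - x))\<^sup>2 + 1 = (- int x)\<^sup>2 + 1] (mod int p)" by (intro cong_add cong_pow) auto
    moreover have "int p dvd (- int x)\<^sup>2 + 1" using x(2) by (simp flip: of_nat_power of_nat_Suc add: add.commute)
    ultimately have "int p dvd (int (p - x))\<^sup>2 + 1" by (simp add: cong_dvd_iff)
    then show "p dvd (p - x)\<^sup>2 + 1" by (metis int_dvd_int_iff of_nat_1 of_nat_add of_nat_power)
    show "p - x < p" using x0 p by simp
    show "p - x \<noteq> x" using p(2) x(1) by presburger
  qed
  have lift: "\<exists>c. c \<in> R (p * M) \<and> [c = a] (mod M) \<and> [c = y] (mod p)" if "a \<in> R M" "y \<in> {x, p - x}" for a y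
  proof -
    obtain c where c: "c < M * p" "[c = a] (mod M)" "[c = y] (mod p)"
      using binary_chinese_remainder_unique_nat[OF cop, of a y] M p by auto
    have "[c\<^sup>2 + 1 = a\<^sup>2 + 1] (mod M)" "[c\<^sup>2 + 1 = y\<^sup>2 + 1] (mod p)"
      using c by (intro cong_add cong_pow cong_refl; simp)+
    then have "M dvd c\<^sup>2 + 1" "p dvd c\<^sup>2 + 1"
      using that x xp by (auto simp: R_def cong_dvd_iff)
    then have "M * p dvd c\<^sup>2 + 1" using cop by (rule divides_mult)
    then show ?thesis using c by (auto simp: R_def mult.commute)
  qed
  define g where "g z = (SOME c. c \<in> R (p * M) \<and> [c = fst z] (mod M) \<and> [c = snd z] (mod p))" for z
  have g: "g z \<in> R (p * M) \<and> [g z = fst z] (mod M) \<and> [g z = snd z] (mod p)" if "z \<in> R M \<times> {x, p - x}" for z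
  proof -
    have "fst z \<in> R M" "snd z \<in> {x, p - x}" using that by auto
    from someI_ex[OF lift[OF this]] show ?thesis unfolding g_def .
  qed
  \<comment> \<open>The value \<open>g z\<close> fixes both components of \<open>z\<close> modulo
    \<open>M\<close> and \<open>p\<close>, and these are already reduced residues.\<close>
  have "inj_on g (R M \<times> {x, p - x})"
  proof (rule inj_onI)
    fix z z' assume z: "z \<in> R M \<times> {x, p - x}" "z' \<in> R M \<times> {x, p - x}" "g z = g z'"
    have "[fst z = fst z'] (mod M)" "[snd z = snd z'] (mod p)"
      using g[OF z(1)] g[OF z(2)] z(3) by (auto simp: cong_def)
    moreover have "fst z < M" "fst z' < M" "snd z < p" "snd z' < p"
      using z x xp by (auto simp: R_def)
    ultimately show "z = z'" by (auto simp: cong_less_modulus_unique_nat prod_eq_iff)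
  qed
  moreover have "g ` (R M \<times> {x, p - x}) \<subseteq> R (p * M)" using g by auto
  moreover have "finite (R (p * M))" by (simp add: R_def)
  ultimately have "card (R M \<times> {x, p - x}) \<le> card (R (p * M))" by (rule card_inj_on_le)
  moreover have "card (R M \<times> {x, p - x}) = card (R M) * 2"
    unfolding card_cartesian_product using xp(3) by (simp add: card_insert_if)
  ultimately have "2 * card (R M) \<le> card (R (p * M))" by simp
  moreover have "2 ^ card P \<le> card (R M)" using insert unfolding R_def M_def by auto
  ultimately have "2 ^ card (insert p P) \<le> card (R (p * M))" using insert.hyps by simp
  moreover have "\<Prod>(insert p P) = p * M" using insert.hyps by (simp add: M_def)
  ultimately show ?case by (simp only: R_def)
qed

text \<open>Thue's pigeonhole argument; squarefreeness rules out \<open>a\<^sup>2 + b\<^sup>2 = 2 * M\<close>.\<close>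

lemma thue_two_squares:
  fixes M c :: nat
  assumes sf: "squarefree M" and M1: "M > 1" and c: "M dvd c\<^sup>2 + 1"
  shows "\<exists>a b :: int. a\<^sup>2 + b\<^sup>2 = int M \<and> coprime a b \<and> [a = int c * b] (mod int M)"
proof -
  define s where "s = floor_sqrt M"
  have s: "s\<^sup>2 \<le> M" "M < (Suc s)\<^sup>2" using floor_sqrt_power2_le[of M] Suc_floor_sqrt_power2_gt[of M] by (simp_all only: s_def)
  \<comment> \<open>There are \<open>(s + 1)\<^sup>2 > M\<close> pairs but only \<open>M\<close>
    residues, so this linear form takes one value at two different pairs; their difference is the
    vector sought.\<close>
  define h where "h z = (int (fst z) - int c * int (snd z)) mod int M" for z :: "nat \<times> nat"
  have "h ` ({..s} \<times> {..s}) \<subseteq> {0..<int M}" using M1 by (auto simp: h_def)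
  then have "card (h ` ({..s} \<times> {..s})) \<le> card {0..<int M}" by (intro card_mono) auto
  also have "\<dots> < card ({..s} \<times> {..s})" using s(2) by (simp add: power2_eq_square)
  finally have "\<not> inj_on h ({..s} \<times> {..s})" using pigeonhole by blast
  then obtain z z' where z: "z \<in> {..s} \<times> {..s}" "z' \<in> {..s} \<times> {..s}" "h z = h z'" "z \<noteq> z'"
    by (auto simp: inj_on_def)
  define a where "a = int (fst z) - int (fst z')"
  define b where "b = int (snd z) - int (snd z')"
  have "[int (fst z) - int c * int (snd z) = int (fst z') - int c * int (snd z')] (mod int M)"
    using z(3) by (simp add: h_def cong_def)
  then have ab: "[a = int c * b] (mod int M)"
    by (simp add: cong_iff_dvd_diff a_def b_def algebra_simps)
  then have "[a\<^sup>2 + b\<^sup>2 = (int c * b)\<^sup>2 + b\<^sup>2] (mod int M)" by (intro cong_add cong_pow) auto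
  moreover have "(int c * b)\<^sup>2 + b\<^sup>2 = int (c\<^sup>2 + 1) * b\<^sup>2" by (simp add: algebra_simps power_mult_distrib)
  moreover have "int M dvd int (c\<^sup>2 + 1)" using c by (simp only: int_dvd_int_iff)
  ultimately have dvd: "int M dvd a\<^sup>2 + b\<^sup>2" by (metis cong_dvd_iff dvd_mult2)
  have abs: "\<bar>a\<bar> \<le> int s" "\<bar>b\<bar> \<le> int s" using z by (auto simp: a_def b_def)
  then have le: "a\<^sup>2 \<le> (int s)\<^sup>2" "b\<^sup>2 \<le> (int s)\<^sup>2" using abs_le_square_iff[of _ "int s"] by auto
  have "a \<noteq> 0 \<or> b \<noteq> 0" using z(4) by (auto simp: a_def b_def prod_eq_iff)
  then have pos: "a\<^sup>2 + b\<^sup>2 > 0" by (simp add: sum_power2_gt_zero_iff)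
  have "s\<^sup>2 \<noteq> M"
  proof
    assume "s\<^sup>2 = M"
    then have "s dvd 1" using squarefreeD[OF sf, of s] by simp
    then show False using \<open>s\<^sup>2 = M\<close> M1 by simp
  qed
  then have "s\<^sup>2 < M" using s(1) by simp
  then have "(int s)\<^sup>2 < int M" by (metis of_nat_less_iff of_nat_power)
  \<comment> \<open>Both squares are at most \<open>s\<^sup>2\<close>, which is strictly below
    \<open>M\<close> because a squarefree \<open>M > 1\<close> is not a square. A positive multiple
    of \<open>M\<close> below \<open>2 * M\<close> is \<open>M\<close> itself.\<close>
  then have lt: "a\<^sup>2 + b\<^sup>2 < 2 * int M" using le by linarith
  obtain q where q: "a\<^sup>2 + b\<^sup>2 = int M * q" using dvd by (auto elim: dvdE)
  have "q > 0" using pos q by (simp add: zero_less_mult_iff)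
  moreover have "q < 2" using lt q M1 by simp
  ultimately have eq: "a\<^sup>2 + b\<^sup>2 = int M" using q by (cases "q = 1") auto
  have "coprime a b"
  proof -
    define d where "d = gcd a b"
    have "d\<^sup>2 dvd a\<^sup>2 + b\<^sup>2" unfolding d_def by (intro dvd_add dvd_power_same) auto
    then have "int ((nat d)\<^sup>2) dvd int M" unfolding eq d_def by simp
    then have "nat d dvd 1" using squarefreeD[OF sf] int_dvd_int_iff by blast
    then show ?thesis by (simp add: d_def coprime_iff_gcd_eq_1)
  qed
  then show ?thesis using eq ab by blast
qed

text \<open>Thue's argument turns each root \<open>c\<close> of -1 modulo \<open>M\<close> into a
  vector with \<open>a = c * b\<close> modulo \<open>M\<close>. As \<open>b\<close> is invertible
  modulo \<open>M\<close>, both \<open>(a, b)\<close> and \<open>(- a, - b)\<close> determine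
  \<open>c\<close>, so different roots give vectors that are neither equal nor opposite.\<close>

lemma many_two_squares:
  fixes t :: nat
  assumes "t \<ge> 1"
  obtains M :: nat and W :: "(int \<times> int) set" where "finite W" "card W \<ge> 2 ^ t"
    "M > 1" "M \<le> (324 * t ^ 4) ^ t"
    "\<And>a b. (a, b) \<in> W \<Longrightarrow> a\<^sup>2 + b\<^sup>2 = int M \<and> coprime a b \<and> (- a, - b) \<notin> W"
proof -
  obtain P where P: "finite P" "card P = t"
    "\<And>p. p \<in> P \<Longrightarrow> prime p \<and> odd p \<and> p \<le> 324 * t ^ 4 \<and> (\<exists>c. p dvd c\<^sup>2 + 1)"
    using many_primes_with_sqrt_minus_one[OF assms] by metis
  define M where "M = \<Prod>P"
  have sf: "squarefree M" unfolding M_def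
    using P(3) by (intro squarefree_prod_coprime) (auto intro: primes_coprime squarefree_prime)
  have "M \<le> (\<Prod>p\<in>P. 324 * t ^ 4)" unfolding M_def using P(3) by (intro prod_mono) auto
  then have M_le: "M \<le> (324 * t ^ 4) ^ t" using P(2) by simp
  have M1: "M > 1"
  proof -
    obtain p where p: "p \<in> P" using P assms by fastforce
    have "M > 0" unfolding M_def using P(3) by (intro prod_pos) (auto simp: prime_gt_0_nat)
    moreover have "p dvd M" unfolding M_def using dvd_prodI[OF P(1) p, of "\<lambda>x. x"] by simp
    ultimately show ?thesis using P(3)[OF p] prime_gt_1_nat[of p] by (meson dvd_imp_le less_le_trans)
  qed
  define C where "C = {c. c < M \<and> M dvd c\<^sup>2 + 1}"
  have "finite C" by (simp add: C_def)
  have "\<forall>c\<in>C. \<exists>z :: int \<times> int. (fst z)\<^sup>2 + (snd z)\<^sup>2 = int M \<and> coprime (fst z) (snd z) \<and> [fst z = int c * snd z] (mod int M)"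
    using thue_two_squares[OF sf M1] by (auto simp: C_def)
  then obtain w :: "nat \<Rightarrow> int \<times> int" where
    w: "\<And>c. c \<in> C \<Longrightarrow> (fst (w c))\<^sup>2 + (snd (w c))\<^sup>2 = int M \<and> coprime (fst (w c)) (snd (w c)) \<and> [fst (w c) = int c * snd (w c)] (mod int M)"
    by (rule bchoice[THEN exE]) blast
  \<comment> \<open>The sign \<open>\<sigma> = 1\<close> serves for injectivity of \<open>w\<close>,
    and \<open>\<sigma> = -1\<close> for excluding opposite vectors.\<close>
  have eqI: "c = c'" if "c \<in> C" "c' \<in> C" "\<sigma> = 1 \<or> \<sigma> = -1" "fst (w c') = \<sigma> * fst (w c)" "snd (w c') = \<sigma> * snd (w c)" for c c' \<sigma>
  proof -
    have \<sigma>: "\<sigma> * \<sigma> = 1" using that(3) by auto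
    have "[\<sigma> * (\<sigma> * fst (w c)) = \<sigma> * (int c' * (\<sigma> * snd (w c)))] (mod int M)"
      using w[OF that(2)] that(4,5) by (intro cong_scalar_left) simp
    moreover have "\<sigma> * (\<sigma> * fst (w c)) = (\<sigma> * \<sigma>) * fst (w c)" "\<sigma> * (int c' * (\<sigma> * snd (w c))) = (\<sigma> * \<sigma>) * (int c' * snd (w c))"
      by simp_all
    ultimately have "[fst (w c) = int c' * snd (w c)] (mod int M)" unfolding \<sigma> by simp
    then have eq: "[int c * snd (w c) = int c' * snd (w c)] (mod int M)"
      using w[OF that(1)] by (meson cong_sym cong_trans)
    have "coprime (snd (w c)) (int M)"
    proof -
      have "coprime (snd (w c)) ((fst (w c))\<^sup>2)" using w[OF that(1)] by (simp add: coprime_commute)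
      then have "coprime (snd (w c)) ((fst (w c))\<^sup>2 + snd (w c) * snd (w c))"
        by (metis coprime_iff_gcd_eq_1 gcd_add_mult add.commute)
      then show ?thesis using w[OF that(1)] by (simp add: power2_eq_square)
    qed
    then have "[int c = int c'] (mod int M)" using eq by (simp add: cong_mult_rcancel)
    then have "[c = c'] (mod M)" by (simp add: cong_int_iff)
    then show ?thesis using that(1,2) by (simp add: C_def cong_less_modulus_unique_nat)
  qed
  have "inj_on w C" using eqI[where \<sigma> = 1] by (intro inj_onI) auto
  then have "card (w ` C) = card C" by (rule card_image)
  moreover have "2 ^ t \<le> card C" using card_sqrt_minus_one_prod[OF P(1)] P(2,3) by (auto simp: C_def M_def)
  moreover have "a\<^sup>2 + b\<^sup>2 = int M \<and> coprime a b \<and> (- a, - b) \<notin> w ` C" if "(a, b) \<in> w ` C" for a b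
  proof -
    from that obtain c where c: "c \<in> C" "w c = (a, b)" by auto
    have "(- a, - b) \<notin> w ` C"
    proof
      assume "(- a, - b) \<in> w ` C"
      then obtain c' where c': "c' \<in> C" "w c' = (- a, - b)" by auto
      then have "c = c'" using eqI[OF c(1) c'(1), of "-1"] c(2) by auto
      then have "a = 0" "b = 0" using c c' by auto
      then show False using w[OF c(1)] c M1 by simp
    qed
    then show ?thesis using w[OF c(1)] c(2) by simp
  qed
  ultimately show ?thesis using that[of "w ` C" M] \<open>finite C\<close> M1 M_le by auto
qed

section \<open>Lattice graphs and the lower bound\<close>

text \<open>Bezout's identity \<open>m * a + n * b = 1\<close> exhibits \<open>x\<close> as
  \<open>m * c + n * d\<close>. It keeps lattice points off the interior of edges and parallel edges
  from crossing.\<close>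

lemma real_multiple_of_coprime:
  fixes a b c d :: int and x :: real
  assumes "coprime a b" "c = x * a" "d = x * b"
  shows "x \<in> \<int>"
proof -
  obtain m n where "m * a + n * b = 1"
    using assms(1) bezout_int[of a b] by (auto simp: coprime_iff_gcd_eq_1)
  then have "real_of_int (m * a + n * b) = 1" by simp
  then have "x = x * (m * a + n * b)" by simp
  also have "\<dots> = of_int (m * c + n * d)" using assms(2,3) by (simp add: algebra_simps)
  finally show ?thesis by (metis Ints_of_int)
qed

text \<open>
  Parallel edges never cross, because the direction vectors are primitive; so pairwise
  crossing edges have distinct directions.
\<close>

lemma max_edges_ge_lattice:
  fixes S W :: "(int \<times> int) set" and M :: nat
  assumes finS: "finite S" "S \<noteq> {}" and finW: "finite W" and M: "M > 0"
    and W: "\<And>a b. (a, b) \<in> W \<Longrightarrow> a\<^sup>2 + b\<^sup>2 = int M \<and> coprime a b \<and> (- a, - b) \<notin> W"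
  shows "(\<Sum>w\<in>W. card {P \<in> S. P + w \<in> S}) \<le> max_edges (card W + 1) (card S)"
proof -
  define pt :: "int \<times> int \<Rightarrow> real^2" where
    "pt P = vector [of_int (fst P) / sqrt M, of_int (snd P) / sqrt M]" for P
  \<comment> \<open>\<open>max_edges\<close> speaks of graphs on naturals, so lattice points are
    numbered by \<open>to_nat\<close>; \<open>f\<close> decodes the number and draws the scaled
    point.\<close>
  define V where "V = to_nat ` S"
  define f where "f i = pt (from_nat i)" for i
  define I where "I = (SIGMA w:W. {P \<in> S. P + w \<in> S})"
  define edge where "edge x = {to_nat (snd x), to_nat (snd x + fst x)}" for x :: "(int \<times> int) \<times> (int \<times> int)"
  have f_to_nat [simp]: "f (to_nat P) = pt P" for P by (simp add: f_def)
  have to_nat_eq [simp]: "to_nat P = to_nat Q \<longleftrightarrow> P = Q" for P Q :: "int \<times> int" by simp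
  have pt_add: "pt (P + Q) = pt P + pt Q" and pt_diff: "pt (P - Q) = pt P - pt Q" for P Q
    by (simp_all add: pt_def vec_eq_iff forall_2 add_divide_distrib diff_divide_distrib)
  have pt_inj: "pt P = pt Q \<longleftrightarrow> P = Q" for P Q
    using M by (simp add: pt_def vec_eq_iff forall_2 prod_eq_iff)
  have norm_pt: "norm (pt w) = 1" if "w \<in> W" for w
  proof -
    have "real_of_int ((fst w)\<^sup>2 + (snd w)\<^sup>2) = real M"
      using W[of "fst w" "snd w"] that by simp
    then show ?thesis using M
      by (simp add: pt_def norm_vec_def L2_set_def sum_2 power_divide flip: add_divide_distrib)
  qed
  have Ints: "x \<in> \<int>" if "w \<in> W" "pt R = x *\<^sub>R pt w" for w R x
  proof (rule real_multiple_of_coprime)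
    show "coprime (fst w) (snd w)" using W[of "fst w" "snd w"] that(1) by simp
    show "of_int (fst R) = x * of_int (fst w)" "of_int (snd R) = x * of_int (snd w)"
      using that(2) M by (simp_all add: pt_def vec_eq_iff forall_2)
  qed
  have W0: "w \<noteq> 0" "- w \<notin> W" if "w \<in> W" for w
    using W[of "fst w" "snd w"] that M by (cases w; auto simp: zero_prod_def)+
  have edgeE: "\<exists>w P. (w, P) \<in> I \<and> (u = to_nat P \<and> v = to_nat (P + w) \<or> v = to_nat P \<and> u = to_nat (P + w))"
    if "{u, v} \<in> edge ` I" for u v
  proof -
    from that obtain x where x: "x \<in> I" "{u, v} = edge x" by (rule imageE)
    have "(u = to_nat (snd x) \<and> v = to_nat (snd x + fst x)) \<or> (u = to_nat (snd x + fst x) \<and> v = to_nat (snd x))"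
      using x(2) unfolding edge_def by (simp only: doubleton_eq_iff)
    then show ?thesis using x(1) by (intro exI[of _ "fst x"] exI[of _ "snd x"]) auto
  qed
  \<comment> \<open>An edge fixes its direction up to sign, and \<open>W\<close> contains no
    opposite vectors, so no edge is counted twice.\<close>
  have "inj_on edge I"
  proof (rule inj_onI)
    fix x y assume xy: "x \<in> I" "y \<in> I" "edge x = edge y"
    obtain w P where x: "x = (w, P)" by (cases x)
    obtain w' P' where y: "y = (w', P')" by (cases y)
    have mem: "w \<in> W" "w' \<in> W" using xy by (auto simp: I_def x y)
    from xy(3) consider "P = P'" "P + w = P' + w'" | "P = P' + w'" "P + w = P'"
      unfolding edge_def x y fst_conv snd_conv doubleton_eq_iff to_nat_eq by blast
    then show "x = y"
    proof cases
      case 1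
      then show ?thesis by (simp add: x y)
    next
      case 2
      then have "P' + (w' + w) = P' + 0" by (simp only: add.assoc add_0_right)
      then have "w' + w = 0" by (simp only: add_left_cancel)
      then have "w = - w'" by (rule minus_unique[symmetric])
      then show ?thesis using W0(2)[OF mem(2)] mem(1) by simp
    qed
  qed
  then have "card (edge ` I) = (\<Sum>w\<in>W. card {P \<in> S. P + w \<in> S})"
    using finS finW unfolding I_def by (simp only: card_image) (rule card_SigmaI; simp)
  moreover have "quasiplanar_unit_distance_graph (card W + 1) V (edge ` I)"
    unfolding quasiplanar_unit_distance_graph_def
  proof (intro conjI exI[of _ f])
    show "simple_graph V (edge ` I)"
      unfolding simple_graph_def
    proof (intro conjI ballI)
      fix e assume "e \<in> edge ` I"
      then obtain w P where "(w, P) \<in> I" "e = edge (w, P)" by auto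
      then show "\<exists>u\<in>V. \<exists>v\<in>V. u \<noteq> v \<and> e = {u, v}"
        using W0(1)[of w]
        by (intro bexI[of _ "to_nat P"] bexI[of _ "to_nat (P + w)"]) (auto simp: edge_def I_def V_def)
    qed (use finS in \<open>simp add: V_def\<close>)
    show "unit_distance_drawing V (edge ` I) f"
      unfolding unit_distance_drawing_def
    proof (intro conjI allI impI ballI)
      show "inj_on f V" by (auto simp: inj_on_def V_def pt_inj)
      fix u v assume "{u, v} \<in> edge ` I"
      then obtain w P where wP: "(w, P) \<in> I"
        and uv: "u = to_nat P \<and> v = to_nat (P + w) \<or> v = to_nat P \<and> u = to_nat (P + w)"
        using edgeE by blast
      have w: "w \<in> W" using wP by (simp add: I_def)
      have "dist (pt P) (pt (P + w)) = 1" using norm_pt[OF w] by (simp add: dist_norm pt_add)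
      then show "dist (f u) (f v) = 1" using uv by (auto simp: dist_commute)
      fix z assume z: "z \<in> V - {u, v}"
      then obtain R :: "int \<times> int" where R: "z = to_nat R" unfolding V_def by blast
      have "pt R \<notin> closed_segment (pt P) (pt (P + w))"
      proof
        assume "pt R \<in> closed_segment (pt P) (pt (P + w))"
        then obtain x where x: "0 \<le> x" "x \<le> 1" "pt R = (1 - x) *\<^sub>R pt P + x *\<^sub>R pt (P + w)"
          unfolding in_segment by blast
        then have eq: "pt (R - P) = x *\<^sub>R pt w" by (simp add: pt_diff pt_add algebra_simps)
        have "x \<in> \<int>" using Ints[OF w eq] .
        then have "x = 0 \<or> x = 1" using x(1,2) by (auto elim!: Ints_cases)
        then have "R = P \<or> R = P + w"
          using x(3) by (elim disjE) (simp_all add: pt_inj)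
        then show False using z R uv by auto
      qed
      then show "f z \<notin> closed_segment (f u) (f v)"
        using uv R by (auto simp: closed_segment_commute)
    qed
    show "\<not> (\<exists>F\<subseteq>edge ` I. finite F \<and> card F = card W + 1 \<and> pairwise (edges_cross f) F)"
    proof
      assume "\<exists>F\<subseteq>edge ` I. finite F \<and> card F = card W + 1 \<and> pairwise (edges_cross f) F"
      then obtain F where F: "F \<subseteq> edge ` I" "finite F" "card F = card W + 1" "pairwise (edges_cross f) F"
        by blast
      define g where "g = inv_into I edge"
      have g: "g e \<in> I" "edge (g e) = e" if "e \<in> F" for e
        using that F(1) by (auto simp: g_def inv_into_into f_inv_into_f)
      have "(fst \<circ> g) ` F \<subseteq> W"
      proof
        fix w assume "w \<in> (fst \<circ> g) ` F"
        then obtain e where "e \<in> F" "w = fst (g e)" by auto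
        then show "w \<in> W" using g(1)[of e] by (auto simp: I_def)
      qed
      \<comment> \<open>Pigeonhole: \<open>card W + 1\<close> edges have only \<open>card W\<close>
        directions available, so two of them are parallel.\<close>
      then have "\<not> inj_on (fst \<circ> g) F"
        using card_inj_on_le[of "fst \<circ> g" F W] finW F(3) by auto
      then obtain e e' where e: "e \<in> F" "e' \<in> F" "e \<noteq> e'" "fst (g e) = fst (g e')"
        by (auto simp: inj_on_def)
      define w where "w = fst (g e)"
      define P where "P = snd (g e)"
      define P' where "P' = snd (g e')"
      have w: "w \<in> W" using g(1)[OF e(1)] by (auto simp: w_def I_def)
      have es: "e = {to_nat P, to_nat (P + w)}" "e' = {to_nat P', to_nat (P' + w)}"
        using g(2)[OF e(1)] g(2)[OF e(2)] e(4) by (simp_all add: edge_def w_def P_def P'_def)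
      have "edges_cross f e e'" using F(4) e by (simp add: pairwise_def)
      then obtain u v u' v' where uv: "e = {u, v}" "e' = {u', v'}"
        "open_segment (f u) (f v) \<inter> open_segment (f u') (f v') \<noteq> {}"
        unfolding edges_cross_def by blast
      have segs: "open_segment (f u) (f v) = open_segment (pt P) (pt (P + w))"
        "open_segment (f u') (f v') = open_segment (pt P') (pt (P' + w))"
        using uv(1,2) unfolding es by (auto simp: doubleton_eq_iff open_segment_commute)
      obtain q where q: "q \<in> open_segment (pt P) (pt (P + w))" "q \<in> open_segment (pt P') (pt (P' + w))"
        using uv(3) unfolding segs by blast
      obtain x where x: "0 < x" "x < 1" "q = (1 - x) *\<^sub>R pt P + x *\<^sub>R pt (P + w)"
        using q(1) unfolding in_segment by blast
      obtain y where y: "0 < y" "y < 1" "q = (1 - y) *\<^sub>R pt P' + y *\<^sub>R pt (P' + w)"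
        using q(2) unfolding in_segment by blast
      have "(1 - x) *\<^sub>R pt P + x *\<^sub>R pt (P + w) = (1 - y) *\<^sub>R pt P' + y *\<^sub>R pt (P' + w)"
        using x(3) y(3) by simp
      then have eq: "pt (P - P') = (y - x) *\<^sub>R pt w" by (simp add: pt_diff pt_add algebra_simps)
      \<comment> \<open>Both parameters lie strictly between 0 and 1, so an integer difference must
        be 0, and the two edges coincide.\<close>
      have "y - x \<in> \<int>" using Ints[OF w eq] .
      then have "y - x = 0" using x(1,2) y(1,2) by (intro Ints_nonzero_abs_less1) auto
      then have "P = P'" using eq pt_inj[of P P'] by (simp add: pt_diff)
      then show False using es e(3) by simp
    qed
  qed
  moreover have "card V = card S" unfolding V_def by (intro card_image inj_onI) (simp only: to_nat_eq)
  moreover have "card S \<ge> 1" using finS by (simp add: Suc_leI card_gt_0_iff)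
  ultimately show ?thesis
    using card_le_max_edges[of "card W + 1" "card S" V "edge ` I"] by simp
qed

section \<open>Grid size, number of primes and the error term\<close>

text \<open>On a grid of side \<open>s = floor_sqrt n\<close>, a direction loses edges only near the
  border, at most \<open>4 * M * s\<close> of them, and \<open>n\<close> exceeds
  \<open>s\<^sup>2\<close> by at most \<open>2 * s\<close>. Together this is at most
  \<open>6 * B * sqrt n\<close> for each of the \<open>K\<close> directions.\<close>

lemma max_edges_ge:
  fixes K t n :: nat
  assumes "K \<le> 2 ^ t" "t \<ge> 1" "n \<ge> 1"
  shows "real (max_edges (K + 1) n) \<ge> real K * (real n - 6 * real ((324 * t ^ 4) ^ t) * sqrt n)"
proof -
  define B where "B = (324 * t ^ 4) ^ t"
  obtain M :: nat and W0 :: "(int \<times> int) set" where W0: "finite W0" "card W0 \<ge> 2 ^ t" "M > 1" "M \<le> B"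
    "\<And>a b. (a, b) \<in> W0 \<Longrightarrow> a\<^sup>2 + b\<^sup>2 = int M \<and> coprime a b \<and> (- a, - b) \<notin> W0"
    using many_two_squares[OF \<open>t \<ge> 1\<close>] unfolding B_def by metis
  have "K \<le> card W0" using W0(2) assms(1) by linarith
  then obtain W where W: "W \<subseteq> W0" "card W = K" "finite W"
    by (rule obtain_subset_with_card_n)
  define s where "s = floor_sqrt n"
  have s: "s\<^sup>2 \<le> n" "n < (Suc s)\<^sup>2"
    using floor_sqrt_power2_le[of n] Suc_floor_sqrt_power2_gt[of n] by (simp_all only: s_def)
  have "real s \<le> sqrt n" using s(1) by (intro real_le_rsqrt) (simp only: of_nat_le_iff flip: of_nat_power)
  define box where "box = {0..<int s} \<times> {0..<int s}"
  have box: "finite box" "card box = s\<^sup>2" by (simp_all add: box_def power2_eq_square)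
  have "infinite (UNIV :: (int \<times> int) set)"
    by (simp add: finite_prod infinite_UNIV_int)
  then have "infinite (- box)"
    using box(1) by (simp only: Compl_eq_Diff_UNIV Diff_infinite_finite not_False_eq_True)
  \<comment> \<open>These points bring the number of vertices to exactly \<open>n\<close>; the
    estimate below counts only edges inside the grid.\<close>
  then obtain T where T: "finite T" "card T = n - s\<^sup>2" "T \<subseteq> - box"
    using infinite_arbitrarily_large by blast
  define S where "S = box \<union> T"
  have S: "finite S" "card S = n"
    using T box s(1) card_Un_disjoint[of box T] by (auto simp: S_def)
  have key: "real n - 6 * real B * sqrt n \<le> real (card {P \<in> S. P + w \<in> S})" if "w \<in> W" for w
  proof (cases "2 * M \<le> s")
    case True
    obtain a b where w: "w = (a, b)" by (cases w)
    have sq: "a\<^sup>2 + b\<^sup>2 = int M" using W0(5)[of a b] that W(1) w by auto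
    have "\<bar>z\<bar> \<le> z\<^sup>2" for z :: int
      using self_le_power[of "\<bar>z\<bar>" 2] by (cases "z = 0") auto
    from this[of a] this[of b] have ab: "\<bar>a\<bar> \<le> int M" "\<bar>b\<bar> \<le> int M" using sq zero_le_power2[of a] zero_le_power2[of b] by linarith+
    \<comment> \<open>Both coordinates of \<open>w\<close> have absolute value at most
      \<open>M\<close>, so translation by \<open>w\<close> keeps the points of this inner square in
      the grid.\<close>
    have "{int M..<int s - int M} \<times> {int M..<int s - int M} \<subseteq> {P \<in> S. P + w \<in> S}"
      using ab by (auto simp: w S_def box_def)
    then have "card ({int M..<int s - int M} \<times> {int M..<int s - int M}) \<le> card {P \<in> S. P + w \<in> S}"
      using S(1) by (intro card_mono) auto
    moreover have "card ({int M..<int s - int M} \<times> {int M..<int s - int M}) = (s - 2 * M)\<^sup>2"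
    proof -
      have "nat (int s - int M - int M) = s - 2 * M" by linarith
      then show ?thesis by (simp add: power2_eq_square card_cartesian_product)
    qed
    ultimately have "real ((s - 2 * M)\<^sup>2) \<le> real (card {P \<in> S. P + w \<in> S})" by simp
    moreover have "real ((s - 2 * M)\<^sup>2) = (real s - 2 * real M)\<^sup>2" using True by (simp add: of_nat_diff)
    moreover have "(real s - 2 * real M)\<^sup>2 \<ge> (real s)\<^sup>2 - 4 * real M * real s"
      by (simp add: power2_eq_square algebra_simps)
    moreover have "real n \<le> (real s)\<^sup>2 + 2 * real s"
    proof -
      have "n \<le> s\<^sup>2 + 2 * s" using s(2) by (simp add: power2_eq_square)
      then have "real n \<le> real (s\<^sup>2 + 2 * s)" by (simp only: of_nat_le_iff)
      then show ?thesis by simp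
    qed
    moreover have "2 * real s + 4 * real M * real s \<le> 6 * real B * sqrt n"
    proof -
      have "(2 + 4 * real M) * real s \<le> (6 * real B) * sqrt n"
        using W0(3,4) \<open>real s \<le> sqrt n\<close> by (intro mult_mono) auto
      then show ?thesis by (simp add: algebra_simps)
    qed
    ultimately show ?thesis by linarith
  next
    case False
    \<comment> \<open>For a grid this small, \<open>sqrt n \<le> 2 * M\<close>, so the left side of
      the claim is at most 0.\<close>
    then have "Suc s \<le> 2 * M" by simp
    then have "(Suc s)\<^sup>2 \<le> (2 * M)\<^sup>2" by (rule power_mono) simp
    then have "n \<le> (2 * M)\<^sup>2" using s(2) by simp
    then have "real n \<le> (2 * real M)\<^sup>2" by (metis of_nat_le_iff of_nat_mult of_nat_numeral of_nat_power)
    then have "sqrt n \<le> 2 * real M" by (intro real_le_lsqrt) auto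
    then have "sqrt n * sqrt n \<le> 6 * real B * sqrt n" using W0(4) by (intro mult_right_mono) auto
    then have "real n \<le> 6 * real B * sqrt n" by simp
    then show ?thesis by (simp add: order_trans[of _ 0])
  qed
  have "real K * (real n - 6 * real B * sqrt n) = (\<Sum>w\<in>W. real n - 6 * real B * sqrt n)"
    using W(2) by simp
  also have "\<dots> \<le> (\<Sum>w\<in>W. real (card {P \<in> S. P + w \<in> S}))" by (intro sum_mono key)
  also have "\<dots> = real (\<Sum>w\<in>W. card {P \<in> S. P + w \<in> S})" by simp
  also have "\<dots> \<le> real (max_edges (card W + 1) (card S))"
    using W0(3,5) W(1,3) S \<open>n \<ge> 1\<close>
    by (intro of_nat_mono max_edges_ge_lattice[of _ _ M]) (auto; blast)+
  finally show ?thesis unfolding W(2) S(2) B_def .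
qed

text \<open>Rounding the exponent up to an integer \<open>t\<close> gives
  \<open>k n \<le> 2 ^ t\<close>, so \<open>t\<close> primes suffice. The error is
  \<open>6 * K * B * sqrt n\<close>, and the constant 1/100 is small enough for \<open>K * B\<close>
  to stay below the fourth root of \<open>n\<close>.\<close>

lemma max_edges_asymptotic:
  fixes k :: "nat \<Rightarrow> nat"
  assumes k2: "\<And>n. n \<ge> 1 \<Longrightarrow> k n \<ge> 2"
    and k: "\<forall>\<^sub>F n in sequentially. real (k n) \<le> 2 powr (1 / 100 * ln (real n) / ln (ln (real n)))"
  shows "\<forall>\<^sub>F n in sequentially. real (max_edges (k n) n) \<ge> (real (k n) - 1) * real n - 6 * real n powr (3 / 4)"
proof -
  have "\<forall>\<^sub>F n :: nat in sequentially. 1 / 100 * ln (real n) / ln (ln (real n)) > 0"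
    by real_asymp
  \<comment> \<open>With \<open>x\<close> the exponent, \<open>ln (x ^ 4)\<close> is asymptotically
    \<open>4 * ln (ln n)\<close>, so the left side is asymptotically \<open>ln n / 25\<close>. The
    factor 648 is 324 from \<open>B\<close> doubled by the estimate
    \<open>K \<le> 2 ^ t\<close>.\<close>
  moreover have "\<forall>\<^sub>F n :: nat in sequentially. (1 / 100 * ln (real n) / ln (ln (real n)) + 1) *
      ln (648 * (1 / 100 * ln (real n) / ln (ln (real n)) + 1) ^ 4) \<le> 1 / 4 * ln (real n)"
    by real_asymp
  ultimately show ?thesis
    using k eventually_ge_at_top[of 1]
  proof eventually_elim
    case (elim n)
    define x where "x = 1 / 100 * ln (real n) / ln (ln (real n))"
    define t where "t = nat \<lceil>x\<rceil>"
    define B where "B = (324 * t ^ 4) ^ t"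
    define K where "K = k n - 1"
    have x: "x > 0" using elim by (simp add: x_def)
    have t: "x \<le> real t" "real t \<le> x + 1" "t \<ge> 1" using x unfolding t_def by linarith+
    have "real (k n) \<le> 2 powr real t"
      using elim(3) powr_mono[OF t(1), of 2] unfolding x_def[symmetric] by linarith
    then have "real (k n) \<le> real (2 ^ t)" by (simp add: powr_realpow)
    then have "k n \<le> 2 ^ t" by (simp only: of_nat_le_iff)
    then have K: "K \<le> 2 ^ t" "k n = K + 1" using k2[OF elim(4)] by (auto simp: K_def)
    have "real K * real B \<le> real (2 ^ t) * real B" using K(1) by (intro mult_right_mono) (simp_all only: of_nat_le_iff of_nat_0_le_iff)
    also have "\<dots> = (2 * (324 * real t ^ 4)) ^ t"
      by (simp only: B_def of_nat_power of_nat_mult of_nat_numeral power_mult_distrib)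
    also have "\<dots> = (648 * real t ^ 4) ^ t" by simp
    also have "\<dots> = exp (real t * ln (648 * real t ^ 4))"
      using t(3) by (simp add: exp_of_nat_mult)
    also have "\<dots> \<le> exp ((x + 1) * ln (648 * (x + 1) ^ 4))"
    proof -
      have "648 * real t ^ 4 \<le> 648 * (x + 1) ^ 4" using t by (intro mult_left_mono power_mono) auto
      moreover have "1 \<le> real t ^ 4" using t(3) by (intro one_le_power) simp
      then have "1 \<le> 648 * real t ^ 4" by linarith
      ultimately show ?thesis using t by (subst exp_le_cancel_iff, intro mult_mono) auto
    qed
    also have "\<dots> \<le> exp (1 / 4 * ln (real n))" using elim(2) by (simp add: x_def)
    also have "\<dots> = real n powr (1 / 4)" using elim(4) by (simp add: powr_def)
    finally have "real K * real B * sqrt n \<le> real n powr (1 / 4) * real n powr (1 / 2)"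
      unfolding powr_half_sqrt[OF of_nat_0_le_iff, symmetric] by (intro mult_right_mono) auto
    also have "\<dots> = real n powr (3 / 4)" by (simp flip: powr_add)
    finally have "6 * (real K * real B * sqrt n) \<le> 6 * real n powr (3 / 4)" by simp
    moreover have "real (max_edges (K + 1) n) \<ge> real K * (real n - 6 * real B * sqrt n)"
      unfolding B_def using K(1) t(3) elim(4) by (rule max_edges_ge)
    ultimately show ?case unfolding K(2) by (simp add: algebra_simps)
  qed
qed

theorem theorem4:
  shows "(\<forall>k n :: nat. k \<ge> 1 \<longrightarrow> n \<ge> 1 \<longrightarrow> max_edges k n < 4 * k * n) \<and>
    (\<exists>c :: real. c > 0 \<and>
      (\<forall>k :: nat \<Rightarrow> nat.
        (\<forall>n\<ge>1. k n \<ge> 2) \<longrightarrow>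
        (\<forall>\<^sub>F n in sequentially.
           real (k n) \<le> 2 powr (c * ln (real n) / ln (ln (real n)))) \<longrightarrow>
        (\<exists>e :: nat \<Rightarrow> real. e \<in> o(\<lambda>n. real n) \<and>
          (\<forall>\<^sub>F n in sequentially.
             real (max_edges (k n) n) \<ge> (real (k n) - 1) * real n - e n))))"
proof (intro conjI)
  show "\<forall>k n :: nat. k \<ge> 1 \<longrightarrow> n \<ge> 1 \<longrightarrow> max_edges k n < 4 * k * n"
    using max_edges_less by blast
  have small: "(\<lambda>n. 6 * real n powr (3 / 4)) \<in> o(\<lambda>n. real n)"
    by real_asymp
  show "\<exists>c :: real. c > 0 \<and>
      (\<forall>k :: nat \<Rightarrow> nat.
        (\<forall>n\<ge>1. k n \<ge> 2) \<longrightarrow>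
        (\<forall>\<^sub>F n in sequentially.
           real (k n) \<le> 2 powr (c * ln (real n) / ln (ln (real n)))) \<longrightarrow>
        (\<exists>e :: nat \<Rightarrow> real. e \<in> o(\<lambda>n. real n) \<and>
          (\<forall>\<^sub>F n in sequentially.
             real (max_edges (k n) n) \<ge> (real (k n) - 1) * real n - e n)))"
    using small max_edges_asymptotic by (intro exI[of _ "1 / 100"] conjI allI impI exI[of _ "\<lambda>n. 6 * real n powr (3 / 4)"]) auto
qed

end
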